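(* Let $a,\lambda$ be real numbers with $a>\lambda>0$, let $T>t_0\geq 0$ and $x_0\in\mathbb{R}$, and put $\rho=\dfrac{1}{\lambda}\ln\dfrac{a}{a-\lambda}>0$ and $\bar t=T-\rho$. Consider the optimal control problem $(FP_1)$: minimize $$J(x,u)=\int_{t_0}^{T}\big[-e^{-\lambda t}(x(t)+u(t))\big]\,dt$$ over $x\in W^{1,1}([t_0,T],\mathbb{R})$ and measurable functions $u:[t_0,T]\to\mathbb{R}$ satisfying $\dot x(t)=-au(t)$ for a.e. $t\in[t_0,T]$, $x(t_0)=x_0$, and $u(t)\in[-1,1]$ for a.e. $t\in[t_0,T]$. Then $(FP_1)$ has a unique local solution $(\bar x,\bar u)$, which is a global solution, where $\bar u(t)=-a^{-1}\dot{\bar x}(t)$ for almost every $t\in[t_0,T]$ and $\bar x$ is described as follows: (a) If $t_0\geq\bar t$ (i.e., $T-t_0\leq\rho$), then $\bar x(t)=x_0-a(t-t_0)$ for all $t\in[t_0,T]$. (b) If $t_0<\bar t$ (i.e., $T-t_0>\rho$), then $$\bar x(t)=\begin{cases}x_0+a(t-t_0), & t\in[t_0,\bar t],\\ x_0-a(t+t_0-2\bar t), & t\in(\bar t,T].\end{cases}$$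
   Context: $W^{1,1}([t_0,T],\mathbb{R}^n)$ is the space of absolutely continuous functions $x:[t_0,T]\to\mathbb{R}^n$ with norm $\|x\|_{W^{1,1}}=\|x(t_0)\|+\int_{t_0}^T\|\dot x(t)\|\,dt$. A feasible process of $(FP_1)$ is a pair $(x,u)$ satisfying all the constraints; controls are identified when they agree almost everywhere. The problem $(FP_1)$ is identified with the equivalent Mayer problem $(FP_{1a})$: minimize $x_2(T)$ over $x=(x_1,x_2)\in W^{1,1}([t_0,T],\mathbb{R}^2)$ and measurable $u:[t_0,T]\to\mathbb{R}$ satisfying $\dot x_1(t)=-au(t)$ and $\dot x_2(t)=-e^{-\lambda t}(x_1(t)+u(t))$ for a.e. $t$, $x(t_0)=(x_0,0)$, and $u(t)\in[-1,1]$ for a.e. $t$. Here $x_1$ plays the role of $x$ and $x_2(t)=\int_{t_0}^t[-e^{-\lambda\tau}(x_1(\tau)+u(\tau))]\,d\tau$, so that $x_2(T)=J(x_1,u)$. A local solution of $(FP_1)$ is a feasible process whose corresponding process $(\bar x,\bar u)$, $\bar x=(\bar x_1,\bar x_2)$, of $(FP_{1a})$ is a $W^{1,1}$ local minimizer: there exists $\delta>0$ such that $\bar x_2(T)\leq x_2(T)$ for every feasible process $(x,u)$ of $(FP_{1a})$ with $\|\bar x-x\|_{W^{1,1}}\leq\delta$. A global solution is one for which this inequality holds for all feasible processes $(x,u)$. *)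

theory Defs
  imports "HOL-Analysis.Analysis"
begin

section \<open>The space of absolutely continuous functions\<close>

text \<open>
  The library has no absolute continuity of functions on an interval (its
  \<^const>\<open>absolutely_continuous\<close> relates measures).  A set \<open>D\<close> that divides its own union is a
  finite family of nonempty compact intervals with pairwise disjoint interiors; the interval
  \<open>k\<close> is \<open>[Inf k, Sup k]\<close>.
\<close>

definition abs_cont_on :: "real set \<Rightarrow> (real \<Rightarrow> 'a::euclidean_space) \<Rightarrow> bool" where
  "abs_cont_on S f \<longleftrightarrow>
     (\<forall>\<epsilon>>0. \<exists>\<delta>>0. \<forall>D. D division_of \<Union>D \<longrightarrow> \<Union>D \<subseteq> S \<longrightarrow> (\<Sum>k\<in>D. Sup k - Inf k) < \<delta> \<longrightarrow>
        (\<Sum>k\<in>D. norm (f (Sup k) - f (Inf k))) < \<epsilon>)"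

definition W11 :: "real \<Rightarrow> real \<Rightarrow> (real \<Rightarrow> 'a::euclidean_space) set" where
  "W11 t0 T = {x. abs_cont_on {t0..T} x}"

text \<open>
  Functions are total; only their values on \<open>[t0, T]\<close> matter, so derivatives are taken within
  that interval.  Where \<open>x\<close> is not differentiable (a null set if \<open>x\<close> is absolutely continuous)
  \<^const>\<open>vector_derivative\<close> has an unspecified value.
\<close>

definition W11_norm :: "real \<Rightarrow> real \<Rightarrow> (real \<Rightarrow> 'a::euclidean_space) \<Rightarrow> real" where
  "W11_norm t0 T x =
     norm (x t0) + (LINT t:{t0..T}|lebesgue. norm (vector_derivative x (at t within {t0..T})))"


section \<open>The problem \<open>(FP\<^sub>1)\<close>\<close>

definition J :: "real \<Rightarrow> real \<Rightarrow> real \<Rightarrow> (real \<Rightarrow> real) \<Rightarrow> (real \<Rightarrow> real) \<Rightarrow> real" where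
  "J lam t0 T x u = (LINT t:{t0..T}|lebesgue. - exp (- lam * t) * (x t + u t))"

definition admissible_control :: "real \<Rightarrow> real \<Rightarrow> (real \<Rightarrow> real) \<Rightarrow> bool" where
  "admissible_control t0 T u \<longleftrightarrow>
     u \<in> borel_measurable (lebesgue_on {t0..T}) \<and>
     (AE t in lebesgue_on {t0..T}. u t \<in> {-1..1})"

definition FP1_feasible ::
  "real \<Rightarrow> real \<Rightarrow> real \<Rightarrow> real \<Rightarrow> (real \<Rightarrow> real) \<Rightarrow> (real \<Rightarrow> real) \<Rightarrow> bool" where
  "FP1_feasible a t0 T x0 x u \<longleftrightarrow>
     x \<in> W11 t0 T \<and> admissible_control t0 T u \<and> x t0 = x0 \<and>
     (AE t in lebesgue_on {t0..T}. (x has_real_derivative - a * u t) (at t within {t0..T}))"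


section \<open>The Mayer problem \<open>(FP\<^sub>1\<^sub>a)\<close>\<close>

text \<open>
  \<open>\<real>\<^sup>2\<close> is rendered as \<^typ>\<open>real \<times> real\<close>, whose norm is the Euclidean one; the
  components of a state \<open>x\<close> are \<open>fst (x t)\<close> and \<open>snd (x t)\<close>.
\<close>

definition FP1a_feasible ::
  "real \<Rightarrow> real \<Rightarrow> real \<Rightarrow> real \<Rightarrow> real \<Rightarrow> (real \<Rightarrow> real \<times> real) \<Rightarrow> (real \<Rightarrow> real) \<Rightarrow> bool" where
  "FP1a_feasible a lam t0 T x0 x u \<longleftrightarrow>
     x \<in> W11 t0 T \<and> admissible_control t0 T u \<and> x t0 = (x0, 0) \<and>
     (AE t in lebesgue_on {t0..T}.
        ((\<lambda>s. fst (x s)) has_real_derivative - a * u t) (at t within {t0..T}) \<and>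
        ((\<lambda>s. snd (x s)) has_real_derivative - exp (- lam * t) * (fst (x t) + u t))
          (at t within {t0..T}))"

definition FP1a_local_minimizer ::
  "real \<Rightarrow> real \<Rightarrow> real \<Rightarrow> real \<Rightarrow> real \<Rightarrow> (real \<Rightarrow> real \<times> real) \<Rightarrow> (real \<Rightarrow> real) \<Rightarrow> bool" where
  "FP1a_local_minimizer a lam t0 T x0 xb ub \<longleftrightarrow>
     FP1a_feasible a lam t0 T x0 xb ub \<and>
     (\<exists>\<delta>>0. \<forall>x u. FP1a_feasible a lam t0 T x0 x u \<longrightarrow>
        W11_norm t0 T (\<lambda>t. xb t - x t) \<le> \<delta> \<longrightarrow> snd (xb T) \<le> snd (x T))"

definition FP1a_global_minimizer ::
  "real \<Rightarrow> real \<Rightarrow> real \<Rightarrow> real \<Rightarrow> real \<Rightarrow> (real \<Rightarrow> real \<times> real) \<Rightarrow> (real \<Rightarrow> real) \<Rightarrow> bool" where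
  "FP1a_global_minimizer a lam t0 T x0 xb ub \<longleftrightarrow>
     FP1a_feasible a lam t0 T x0 xb ub \<and>
     (\<forall>x u. FP1a_feasible a lam t0 T x0 x u \<longrightarrow> snd (xb T) \<le> snd (x T))"


section \<open>Solutions of \<open>(FP\<^sub>1)\<close>\<close>

text \<open>
  The second component of the state corresponding to \<open>(x, u)\<close> is the cost accumulated up to
  time \<open>t\<close>; at \<open>t = T\<close> it is the objective of \<open>(FP\<^sub>1)\<close>.
\<close>

definition mayer_state ::
  "real \<Rightarrow> real \<Rightarrow> (real \<Rightarrow> real) \<Rightarrow> (real \<Rightarrow> real) \<Rightarrow> real \<Rightarrow> real \<times> real" where
  "mayer_state lam t0 x u t = (x t, J lam t0 t x u)"

definition FP1_local_solution ::
  "real \<Rightarrow> real \<Rightarrow> real \<Rightarrow> real \<Rightarrow> real \<Rightarrow> (real \<Rightarrow> real) \<Rightarrow> (real \<Rightarrow> real) \<Rightarrow> bool" where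
  "FP1_local_solution a lam t0 T x0 x u \<longleftrightarrow>
     FP1_feasible a t0 T x0 x u \<and> FP1a_local_minimizer a lam t0 T x0 (mayer_state lam t0 x u) u"

definition FP1_global_solution ::
  "real \<Rightarrow> real \<Rightarrow> real \<Rightarrow> real \<Rightarrow> real \<Rightarrow> (real \<Rightarrow> real) \<Rightarrow> (real \<Rightarrow> real) \<Rightarrow> bool" where
  "FP1_global_solution a lam t0 T x0 x u \<longleftrightarrow>
     FP1_feasible a t0 T x0 x u \<and> FP1a_global_minimizer a lam t0 T x0 (mayer_state lam t0 x u) u"

end

theory Submission
  imports Defs
begin

text \<open>
  With \<open>E t = (exp (- lam * t) - exp (- lam * T)) / lam\<close> one has, along every feasible process,
  \<open>(snd x - E * fst x)' = phi * u\<close> for \<open>phi t = a * E t - exp (- lam * t)\<close>, so the cost is a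
  constant plus the integral of \<open>phi * u\<close>.  The function \<open>phi\<close> is strictly decreasing with
  zero \<open>tb\<close>, hence the bang-bang control equal to \<open>-1\<close> before \<open>tb\<close> and to \<open>1\<close> after it is the
  unique global minimizer.  The problem is convex with affine cost, so local minimizers are
  global.  Integrating the derivative of \<open>snd x - E * fst x\<close> requires the fundamental theorem
  of calculus for absolutely continuous functions.
\<close>

section \<open>Absolutely continuous functions\<close>

text \<open>Links the endpoint differences \<open>Sup k - Inf k\<close> in
  \<open>abs_cont_on\<close> with the contents that occur in gauge integrals.\<close>

lemma division_interval_real:
  fixes D :: "real set set"
  assumes "D division_of U" and "k \<in> D"
  shows "Inf k \<le> Sup k" and "k = {Inf k..Sup k}" and "measure lborel k = Sup k - Inf k"
proof -
  obtain a b where k: "k = cbox a b" "k \<noteq> {}"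
    using division_ofD(3,4)[OF assms(1) assms(2)] by blast
  then have "a \<le> b" by auto
  then show "Inf k \<le> Sup k" "k = {Inf k..Sup k}" "measure lborel k = Sup k - Inf k"
    using k by auto
qed

text \<open>Both sides are integrals of the constant 1, over \<open>\<Union>D\<close> and over
  \<open>U\<close>, so monotonicity in the domain applies. It lets a measure bound on an open cover
  serve as the length condition in absolute continuity.\<close>

lemma sum_content_division_le_measure:
  fixes D :: "'a::euclidean_space set set"
  assumes "D division_of \<Union>D" "\<Union>D \<subseteq> U" "U \<in> lmeasurable"
  shows "sum (measure lborel) D \<le> measure lebesgue U"
proof (rule has_integral_subset_le)
  show "((\<lambda>x. 1::real) has_integral sum (measure lborel) D) (\<Union>D)"
  proof (rule has_integral_combine_division[OF assms(1)])
    fix k assume "k \<in> D"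
    then obtain a b where "k = cbox a b" using division_ofD(4)[OF assms(1)] by blast
    then show "((\<lambda>x. 1::real) has_integral measure lborel k) k"
      using has_integral_const[of "1::real" a b] by simp
  qed
  show "((\<lambda>x. 1::real) has_integral measure lebesgue U) U"
    using assms(3) by (simp add: lmeasurable_iff_integrable_on lmeasure_integral has_integral_integral)
qed (use assms in auto)

section \<open>Closure properties of absolute continuity\<close>

text \<open>The definition is tested on divisions that consist of the single interval
  \<open>{r..s}\<close>.\<close>

lemma abs_cont_on_imp_continuous_on:
  assumes "abs_cont_on {a..b} f"
  shows "continuous_on {a..b} f"
  unfolding continuous_on_iff
proof (intro ballI allI impI)
  fix x e :: real assume x: "x \<in> {a..b}" and "e > 0"
  obtain d where d: "d > 0"
    "\<forall>D. D division_of \<Union>D \<longrightarrow> \<Union>D \<subseteq> {a..b} \<longrightarrow> (\<Sum>k\<in>D. Sup k - Inf k) < d \<longrightarrow>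
        (\<Sum>k\<in>D. norm (f (Sup k) - f (Inf k))) < e"
    using assms \<open>e > 0\<close> unfolding abs_cont_on_def by blast
  have *: "norm (f s - f r) < e" if "r \<le> s" "r \<in> {a..b}" "s \<in> {a..b}" "s - r < d" for r s
  proof -
    have "{{r..s}} division_of \<Union>{{r..s}}"
      using division_of_self[of r s] that(1) by simp
    then have "(\<Sum>k\<in>{{r..s}}. norm (f (Sup k) - f (Inf k))) < e"
      by (rule d(2)[rule_format]) (use that in auto)
    then show ?thesis using that by simp
  qed
  have "dist (f y) (f x) < e" if "y \<in> {a..b}" "dist y x < d" for y
    using *[of x y] *[of y x] that x
    by (cases "x \<le> y") (auto simp: dist_norm norm_minus_commute)
  then show "\<exists>d>0. \<forall>y\<in>{a..b}. dist y x < d \<longrightarrow> dist (f y) (f x) < e"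
    using d(1) by blast
qed

text \<open>Common source of the closure properties: each of them reduces to an estimate of a single
  increment, which is then summed over the division.\<close>

lemma abs_cont_on_dominated:
  assumes f: "abs_cont_on S f" and g: "abs_cont_on S g" and "C \<ge> 0"
    and le: "\<And>r s. r \<le> s \<Longrightarrow> {r..s} \<subseteq> S \<Longrightarrow>
      norm (h s - h r) \<le> C * norm (f s - f r) + C * norm (g s - g r)"
  shows "abs_cont_on S h"
  unfolding abs_cont_on_def
proof (intro allI impI)
  fix e :: real assume "e > 0"
  \<comment> \<open>With this choice \<open>2 * C * e' < e\<close>; the added 1 covers the case
    \<open>C = 0\<close>.\<close>
  define e' where "e' = e / (2 * (C + 1))"
  have "e' > 0" using \<open>e > 0\<close> \<open>C \<ge> 0\<close> by (simp add: e'_def)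
  obtain d1 where d1: "d1 > 0"
    "\<forall>D. D division_of \<Union>D \<longrightarrow> \<Union>D \<subseteq> S \<longrightarrow> (\<Sum>k\<in>D. Sup k - Inf k) < d1 \<longrightarrow>
        (\<Sum>k\<in>D. norm (f (Sup k) - f (Inf k))) < e'"
    using f \<open>e' > 0\<close> unfolding abs_cont_on_def by blast
  obtain d2 where d2: "d2 > 0"
    "\<forall>D. D division_of \<Union>D \<longrightarrow> \<Union>D \<subseteq> S \<longrightarrow> (\<Sum>k\<in>D. Sup k - Inf k) < d2 \<longrightarrow>
        (\<Sum>k\<in>D. norm (g (Sup k) - g (Inf k))) < e'"
    using g \<open>e' > 0\<close> unfolding abs_cont_on_def by blast
  have "(\<Sum>k\<in>D. norm (h (Sup k) - h (Inf k))) < e"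
    if D: "D division_of \<Union>D" "\<Union>D \<subseteq> S" and lt: "(\<Sum>k\<in>D. Sup k - Inf k) < min d1 d2" for D
  proof -
    have "(\<Sum>k\<in>D. norm (h (Sup k) - h (Inf k)))
        \<le> (\<Sum>k\<in>D. C * norm (f (Sup k) - f (Inf k)) + C * norm (g (Sup k) - g (Inf k)))"
    proof (rule sum_mono)
      fix k assume "k \<in> D"
      note k = division_interval_real[OF D(1) this]
      have "{Inf k..Sup k} \<subseteq> S" using D(2) \<open>k \<in> D\<close> k(2) by blast
      then show "norm (h (Sup k) - h (Inf k))
        \<le> C * norm (f (Sup k) - f (Inf k)) + C * norm (g (Sup k) - g (Inf k))"
        using le k(1) by blast
    qed
    also have "\<dots> = C * (\<Sum>k\<in>D. norm (f (Sup k) - f (Inf k)))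
        + C * (\<Sum>k\<in>D. norm (g (Sup k) - g (Inf k)))"
      by (simp add: sum.distrib sum_distrib_left)
    also have "\<dots> \<le> C * e' + C * e'"
      using d1(2)[rule_format, OF D] d2(2)[rule_format, OF D] lt \<open>C \<ge> 0\<close>
      by (intro add_mono mult_left_mono) auto
    also have "\<dots> < e"
    proof -
      have "e = 2 * (C + 1) * e'" using \<open>C \<ge> 0\<close> by (simp add: e'_def)
      then show ?thesis using \<open>e' > 0\<close> by (simp add: algebra_simps)
    qed
    finally show ?thesis .
  qed
  then show "\<exists>\<delta>>0. \<forall>D. D division_of \<Union>D \<longrightarrow> \<Union>D \<subseteq> S \<longrightarrow> (\<Sum>k\<in>D. Sup k - Inf k) < \<delta> \<longrightarrow>
        (\<Sum>k\<in>D. norm (h (Sup k) - h (Inf k))) < e"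
    using d1(1) d2(1) by (intro exI[of _ "min d1 d2"]) auto
qed

lemma abs_cont_on_id: "abs_cont_on S (\<lambda>t::real. t)"
  unfolding abs_cont_on_def
proof (intro allI impI)
  fix e :: real assume "e > 0"
  have "(\<Sum>k\<in>D. norm (Sup k - Inf k)) = (\<Sum>k\<in>D. Sup k - Inf k)"
    if "D division_of \<Union>D" for D :: "real set set"
    by (rule sum.cong) (use division_interval_real(1)[OF that] in auto)
  then show "\<exists>\<delta>>0. \<forall>D. D division_of \<Union>D \<longrightarrow> \<Union>D \<subseteq> S \<longrightarrow> (\<Sum>k\<in>D. Sup k - Inf k) < \<delta> \<longrightarrow>
        (\<Sum>k\<in>D. norm (Sup k - Inf k)) < e"
    using \<open>e > 0\<close> by (intro exI[of _ e]) auto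
qed

text \<open>The increments are dominated by those of the identity, which is used for both comparison
  functions.\<close>

lemma abs_cont_on_Lipschitz:
  assumes "C \<ge> 0"
    and "\<And>r s. r \<le> s \<Longrightarrow> {r..s} \<subseteq> S \<Longrightarrow> norm (h s - h r) \<le> C * (s - r)"
  shows "abs_cont_on S h"
proof (rule abs_cont_on_dominated[OF abs_cont_on_id abs_cont_on_id assms(1)])
  fix r s :: real assume "r \<le> s" "{r..s} \<subseteq> S"
  with assms(2)[OF this] \<open>C \<ge> 0\<close>
  show "norm (h s - h r) \<le> C * norm (s - r) + C * norm (s - r)"
    by (smt (verit) mult_nonneg_nonneg real_norm_def)
qed

lemma abs_cont_on_bounded_linear:
  assumes "abs_cont_on S f" "bounded_linear L"
  shows "abs_cont_on S (\<lambda>t. L (f t))"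
proof -
  obtain K where K: "0 \<le> K" "\<And>x. norm (L x) \<le> norm x * K"
    using bounded_linear.nonneg_bounded[OF assms(2)] by blast
  show ?thesis
  proof (rule abs_cont_on_dominated[OF assms(1) assms(1) K(1)])
    fix r s :: real
    have "norm (L (f s) - L (f r)) \<le> K * norm (f s - f r)"
      using K(2)[of "f s - f r"] by (simp add: linear_diff[OF bounded_linear.linear[OF assms(2)]] mult.commute)
    then show "norm (L (f s) - L (f r)) \<le> K * norm (f s - f r) + K * norm (f s - f r)"
      using K(1) by (smt (verit) mult_nonneg_nonneg norm_ge_zero)
  qed
qed

lemma abs_cont_on_add:
  assumes "abs_cont_on S f" "abs_cont_on S g"
  shows "abs_cont_on S (\<lambda>t. f t + g t)"
  by (rule abs_cont_on_dominated[OF assms, of 1])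
    (auto simp: add_diff_add intro: norm_triangle_ineq)

lemma abs_cont_on_diff:
  assumes "abs_cont_on S f" "abs_cont_on S g"
  shows "abs_cont_on S (\<lambda>t. f t - g t)"
  using abs_cont_on_add[OF assms(1) abs_cont_on_bounded_linear[OF assms(2), of uminus]]
  by (simp add: bounded_linear_minus)

lemma abs_cont_on_Pair:
  assumes "abs_cont_on S f" "abs_cont_on S g"
  shows "abs_cont_on S (\<lambda>t. (f t, g t))"
  by (rule abs_cont_on_dominated[OF assms, of 1]) (auto intro: norm_Pair_le)

text \<open>Both factors are continuous on a compact interval, hence bounded. The product rule for
  increments then bounds the increment of the product by those of \<open>f\<close> and
  \<open>g\<close>.\<close>

lemma abs_cont_on_mult:
  fixes f g :: "real \<Rightarrow> real"
  assumes f: "abs_cont_on {a..b} f" and g: "abs_cont_on {a..b} g"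
  shows "abs_cont_on {a..b} (\<lambda>t. f t * g t)"
proof -
  have "bounded (f ` {a..b})" "bounded (g ` {a..b})"
    using f g by (auto intro!: compact_imp_bounded compact_continuous_image abs_cont_on_imp_continuous_on)
  then obtain A B where A: "\<And>t. t \<in> {a..b} \<Longrightarrow> \<bar>f t\<bar> \<le> A" and B: "\<And>t. t \<in> {a..b} \<Longrightarrow> \<bar>g t\<bar> \<le> B"
    unfolding bounded_iff by (metis image_eqI real_norm_def)
  show ?thesis
  proof (rule abs_cont_on_dominated[OF f g, of "max 0 (max A B)"])
    fix r s :: real assume "r \<le> s" "{r..s} \<subseteq> {a..b}"
    then have rs: "r \<in> {a..b}" "s \<in> {a..b}" by auto
    have "f s * g s - f r * g r = (f s - f r) * g s + f r * (g s - g r)"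
      by (simp add: algebra_simps)
    then have "norm (f s * g s - f r * g r) \<le> \<bar>g s\<bar> * norm (f s - f r) + \<bar>f r\<bar> * norm (g s - g r)"
      by (metis abs_mult abs_triangle_ineq mult.commute real_norm_def)
    also have "\<dots> \<le> max 0 (max A B) * norm (f s - f r) + max 0 (max A B) * norm (g s - g r)"
      using A[OF rs(1)] B[OF rs(2)] by (intro add_mono mult_right_mono) auto
    finally show "norm (f s * g s - f r * g r)
      \<le> max 0 (max A B) * norm (f s - f r) + max 0 (max A B) * norm (g s - g r)" .
  qed auto
qed

lemma abs_cont_on_subset: "abs_cont_on S f \<Longrightarrow> S' \<subseteq> S \<Longrightarrow> abs_cont_on S' f"
  unfolding abs_cont_on_def by (meson order_trans)

lemma abs_cont_on_bounded_derivative: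
  assumes deriv: "\<And>t. t \<in> {a..b} \<Longrightarrow> (f has_real_derivative f' t) (at t within {a..b})"
    and bound: "\<And>t. t \<in> {a..b} \<Longrightarrow> \<bar>f' t\<bar> \<le> C" and "C \<ge> 0"
  shows "abs_cont_on {a..b} f"
proof (rule abs_cont_on_Lipschitz[OF \<open>C \<ge> 0\<close>])
  fix r s :: real assume "r \<le> s" "{r..s} \<subseteq> {a..b}"
  then have rs: "r \<in> {a..b}" "s \<in> {a..b}" by auto
  show "norm (f s - f r) \<le> C * (s - r)"
    using field_differentiable_bound[OF _ deriv, of C s r] bound rs \<open>r \<le> s\<close> by simp
qed

section \<open>The fundamental theorem of calculus for absolutely continuous functions\<close>

text \<open>
  The gauge is fine enough for the straddle estimate at points of differentiability, and keeps
  the intervals tagged in \<open>N\<close> inside an open set of small measure, where absolute continuity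
  bounds the total increment of \<open>f\<close>.
\<close>

theorem abs_cont_on_has_integral:
  fixes f :: "real \<Rightarrow> 'a::euclidean_space"
  assumes f: "abs_cont_on {a..b} f" and "a \<le> b" and N: "negligible N"
    and deriv: "\<And>t. t \<in> {a..b} - N \<Longrightarrow> (f has_vector_derivative f' t) (at t within {a..b})"
  shows "(f' has_integral (f b - f a)) {a..b}"
proof -
  \<comment> \<open>With the integrand set to 0 on \<open>N\<close>, an interval tagged in
    \<open>N\<close> contributes only the increment of \<open>f\<close> to the error. The final
    spike argument returns to \<open>f'\<close>.\<close>
  define g where "g = (\<lambda>t. if t \<in> N then 0 else f' t)"
  have "(g has_integral (f b - f a)) {a..b}"
    unfolding has_integral_real
  proof (intro allI impI)
    fix e :: real assume "e > 0"
    \<comment> \<open>The differentiable points will cost at most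
      \<open>e' * (b - a) \<le> e / 2\<close>; the added 1 keeps the denominator positive when
      \<open>a = b\<close>.\<close>
    define e' where "e' = e / (2 * (b - a + 1))"
    have "e' > 0" using \<open>e > 0\<close> \<open>a \<le> b\<close> by (simp add: e'_def)
    have "\<exists>d>0. t \<in> {a..b} - N \<longrightarrow> (\<forall>y\<in>{a..b}. norm (y - t) < d \<longrightarrow>
        norm (f y - f t - (y - t) *\<^sub>R f' t) \<le> e' * norm (y - t))" for t
    proof (cases "t \<in> {a..b} - N")
      case True
      then show ?thesis
        using deriv[OF True] \<open>e' > 0\<close>
        unfolding has_vector_derivative_def has_derivative_within_alt by blast
    next
      case False
      then show ?thesis using zero_less_one by blast
    qed
    then obtain d where d: "\<And>t. d t > 0"
      and dN: "\<And>t y. t \<in> {a..b} - N \<Longrightarrow> y \<in> {a..b} \<Longrightarrow> norm (y - t) < d t \<Longrightarrow>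
        norm (f y - f t - (y - t) *\<^sub>R f' t) \<le> e' * norm (y - t)"
      by metis
    obtain \<delta> where \<delta>: "\<delta> > 0"
    "\<forall>D. D division_of \<Union>D \<longrightarrow> \<Union>D \<subseteq> {a..b} \<longrightarrow> (\<Sum>k\<in>D. Sup k - Inf k) < \<delta> \<longrightarrow>
        (\<Sum>k\<in>D. norm (f (Sup k) - f (Inf k))) < e / 2"
    using f half_gt_zero[OF \<open>e > 0\<close>] unfolding abs_cont_on_def by blast
    obtain U where U: "open U" "N \<subseteq> U" "U - N \<in> lmeasurable" "emeasure lebesgue (U - N) < ennreal \<delta>"
      by (rule sets_lebesgue_outer_open[OF negligible_imp_sets[OF N] \<delta>(1)])
    have Nnull: "N \<in> null_sets lebesgue" using N by (simp add: negligible_iff_null_sets)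
    have UN: "U = (U - N) \<union> N" using U(2) by blast
    have eU: "emeasure lebesgue U = emeasure lebesgue (U - N)"
      by (subst UN) (rule emeasure_Un_null_set, use U(3) Nnull in auto)
    have Um: "U \<in> lmeasurable"
      by (subst UN) (rule fmeasurable.Un, use U(3) N negligible_iff_measure in auto)
    have "measure lebesgue U < \<delta>"
      using U(4) eU \<delta>(1) by (metis Um emeasure_eq_measure2 ennreal_less_iff measure_nonneg)
    define G where "G = (\<lambda>t. if t \<in> N then U else ball t (d t))"
    have gauge: "gauge G" using U(1,2) d by (auto simp: gauge_def G_def)
    have less: "norm ((\<Sum>(x,k)\<in>p. measure lborel k *\<^sub>R g x) - (f b - f a)) < e"
      if p: "p tagged_division_of {a..b}" and fine: "G fine p" for p
    proof -
      note pD = tagged_division_ofD[OF p]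
      define q where "q = {(x,k) \<in> p. x \<in> N}"
      have kE: "Inf k \<in> {a..b} \<and> Sup k \<in> {a..b} \<and> Inf k \<le> x \<and> x \<le> Sup k \<and> measure lborel k = Sup k - Inf k
          \<and> k = {Inf k..Sup k}"
        if "(x, k) \<in> p" for x k
      proof -
        obtain r s where "k = cbox r s" using pD(4)[OF \<open>(x, k) \<in> p\<close>] by blast
        then show ?thesis using pD(2,3)[OF that] by auto
      qed
      have good: "norm (measure lborel k *\<^sub>R g x - (f (Sup k) - f (Inf k))) \<le> e' * measure lborel k"
        if xk: "(x, k) \<in> p" "x \<notin> N" for x k
      proof -
        note k = kE[OF xk(1)]
        have "k \<subseteq> ball x (d x)" using fineD[OF fine xk(1)] xk(2) by (simp add: G_def)
        then have nr: "norm (Sup k - x) < d x" "norm (Inf k - x) < d x"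
          using k by (smt (verit, ccfv_threshold) atLeastAtMost_iff dist_norm mem_ball norm_minus_commute subsetD)+
        have x: "x \<in> {a..b} - N" using xk pD(2,3)[OF xk(1)] by auto
        have len: "measure lborel k = Sup k - Inf k" using k by simp
        \<comment> \<open>Both endpoint increments are taken from the tag \<open>x\<close>. Since
          \<open>x\<close> lies between the endpoints, the two distances to it add up to the length
          of \<open>k\<close>.\<close>
        have "measure lborel k *\<^sub>R g x - (f (Sup k) - f (Inf k)) =
            (f (Inf k) - f x - (Inf k - x) *\<^sub>R f' x) - (f (Sup k) - f x - (Sup k - x) *\<^sub>R f' x)"
          using xk(2) unfolding len by (simp add: g_def algebra_simps)
        also have "norm \<dots> \<le> e' * norm (Inf k - x) + e' * norm (Sup k - x)"
          using k by (intro order_trans[OF norm_triangle_ineq4 add_mono] dN[OF x _ nr(2)] dN[OF x _ nr(1)]) auto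
        also have "\<dots> = e' * measure lborel k"
          using k unfolding len by (simp add: algebra_simps)
        finally show ?thesis .
      qed
      have qp: "q tagged_partial_division_of {a..b}"
        by (rule tagged_partial_division_subset[of p]) (use p in \<open>auto simp: tagged_division_of_def q_def\<close>)
      define D where "D = snd ` q"
      have D: "D division_of \<Union>D"
        unfolding D_def by (rule partial_division_of_tagged_division[OF qp])
      have DU: "\<Union>D \<subseteq> U" and Dab: "\<Union>D \<subseteq> {a..b}"
        using fineD[OF fine] pD(3) by (fastforce simp: D_def q_def G_def)+
      have "(\<Sum>k\<in>D. Sup k - Inf k) = sum (measure lborel) D"
        by (rule sum.cong) (use division_interval_real(3)[OF D] in auto)
      also have "\<dots> < \<delta>"
        using sum_content_division_le_measure[OF D DU Um] \<open>measure lebesgue U < \<delta>\<close> by simp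
      finally have small: "(\<Sum>k\<in>D. norm (f (Sup k) - f (Inf k))) < e / 2"
        using \<delta>(2)[rule_format, OF D Dab] by simp
      \<comment> \<open>Passing from a sum over tagged pairs to one over intervals needs a summand
        that vanishes on boxes with empty interior. Singletons satisfy this by themselves; the empty
        set is set to 0 explicitly, as its \<open>Sup\<close> and \<open>Inf\<close> carry no
        information.\<close>
      define h where "h = (\<lambda>k. if k = {} then 0 else norm (f (Sup k) - f (Inf k)))"
      have "(\<Sum>(x,k)\<in>q. norm (f (Sup k) - f (Inf k))) = (\<Sum>(x,k)\<in>q. h k)"
        by (rule sum.cong) (use pD(2) in \<open>fastforce simp: q_def h_def\<close>)+
      also have "\<dots> = sum h D"
        unfolding D_def
        by (rule sum.over_tagged_division_lemma[OF tagged_partial_division_of_Union_self[OF qp]])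
          (auto simp: h_def)
      also have "\<dots> = (\<Sum>k\<in>D. norm (f (Sup k) - f (Inf k)))"
        by (rule sum.cong) (use division_ofD(3)[OF D] in \<open>auto simp: h_def\<close>)
      finally have bad: "(\<Sum>(x,k)\<in>q. norm (f (Sup k) - f (Inf k))) < e / 2" using small by simp
      \<comment> \<open>The increments of \<open>f\<close> over \<open>p\<close> telescope to
        \<open>f b - f a\<close>, so the error splits into one term per tagged interval.\<close>
      have "(\<Sum>(x,k)\<in>p. measure lborel k *\<^sub>R g x) - (f b - f a)
          = (\<Sum>(x,k)\<in>p. measure lborel k *\<^sub>R g x - (f (Sup k) - f (Inf k)))"
        by (simp add: additive_tagged_division_1[OF \<open>a \<le> b\<close> p, symmetric] sum_subtractf case_prod_unfold)
      also have "norm \<dots> \<le> (\<Sum>(x,k)\<in>p. e' * measure lborel k +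
          (if x \<in> N then norm (f (Sup k) - f (Inf k)) else 0))"
      proof (rule order_trans[OF norm_sum sum_mono], clarify)
        fix x k assume "(x, k) \<in> p"
        then show "norm (measure lborel k *\<^sub>R g x - (f (Sup k) - f (Inf k)))
          \<le> e' * measure lborel k + (if x \<in> N then norm (f (Sup k) - f (Inf k)) else 0)"
          using good[of x k] \<open>e' > 0\<close> by (auto simp: g_def norm_minus_commute)
      qed
      also have "\<dots> = e' * (\<Sum>(x,k)\<in>p. measure lborel k) + (\<Sum>(x,k)\<in>q. norm (f (Sup k) - f (Inf k)))"
      proof -
        have "(\<Sum>(x,k)\<in>p. if x \<in> N then norm (f (Sup k) - f (Inf k)) else 0)
            = (\<Sum>(x,k)\<in>q. norm (f (Sup k) - f (Inf k)))"
          unfolding q_def by (rule sum.mono_neutral_cong_right) (use pD(1) in \<open>auto split: if_splits\<close>)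
        then show ?thesis by (simp add: case_prod_unfold sum.distrib sum_distrib_left)
      qed
      also have "(\<Sum>(x,k)\<in>p. measure lborel k) = b - a"
        using additive_content_tagged_division[of p a b] p \<open>a \<le> b\<close> by simp
      also have "e' * (b - a) + (\<Sum>(x,k)\<in>q. norm (f (Sup k) - f (Inf k))) < e / 2 + e / 2"
        using bad \<open>e > 0\<close> \<open>a \<le> b\<close> by (intro add_le_less_mono) (auto simp: e'_def field_simps)
      finally show ?thesis by simp
    qed
    show "\<exists>\<gamma>. gauge \<gamma> \<and> (\<forall>\<D>. \<D> tagged_division_of {a..b} \<and> \<gamma> fine \<D> \<longrightarrow>
        norm ((\<Sum>(x,k)\<in>\<D>. measure lborel k *\<^sub>R g x) - (f b - f a)) < e)"
      by (intro exI[of _ G] conjI allI impI gauge) (elim conjE, rule less)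
  qed
  then show ?thesis
    by (rule has_integral_spike[OF N, rotated]) (auto simp: g_def)
qed

section \<open>Almost-everywhere statements and integrals\<close>

text \<open>Translates the \<open>AE\<close> conditions of the control problem into the negligible
  exceptional sets of the gauge integral.\<close>

lemma AE_lebesgue_on_iff_negligible:
  assumes "S \<in> sets lebesgue"
  shows "(AE t in lebesgue_on S. P t) \<longleftrightarrow> negligible {t \<in> S. \<not> P t}"
  using assms
  by (simp add: AE_restrict_space_iff completion.AE_iff_null_sets negligible_iff_null_sets)

lemma abs_cont_on_AE_has_integral:
  fixes f :: "real \<Rightarrow> 'a::euclidean_space"
  assumes "abs_cont_on {a..b} f" "a \<le> b"
    and "AE t in lebesgue_on {a..b}. (f has_vector_derivative f' t) (at t within {a..b})"
  shows "(f' has_integral (f b - f a)) {a..b}"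
  by (rule abs_cont_on_has_integral[OF assms(1,2)
        iffD1[OF AE_lebesgue_on_iff_negligible assms(3)]]) auto

text \<open>The fundamental theorem is applied on \<open>{a..s}\<close>, to which the derivative
  within \<open>{a..b}\<close> restricts.\<close>

lemma abs_cont_on_AE_zero_derivative:
  fixes f :: "real \<Rightarrow> 'a::euclidean_space"
  assumes f: "abs_cont_on {a..b} f" and s: "s \<in> {a..b}"
    and "AE t in lebesgue_on {a..b}. (f has_vector_derivative 0) (at t within {a..b})"
  shows "f s = f a"
proof -
  let ?N = "{t \<in> {a..b}. \<not> (f has_vector_derivative 0) (at t within {a..b})}"
  have N: "negligible ?N" using assms(3) by (subst (asm) AE_lebesgue_on_iff_negligible) auto
  have sub: "{a..s} \<subseteq> {a..b}" using s by auto
  have "((\<lambda>_. 0) has_integral (f s - f a)) {a..s}"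
  proof (rule abs_cont_on_has_integral[OF abs_cont_on_subset[OF f sub] _ N])
    fix t assume "t \<in> {a..s} - ?N"
    then show "(f has_vector_derivative 0) (at t within {a..s})"
      using sub by (auto intro: has_vector_derivative_within_subset)
  qed (use s in auto)
  then show ?thesis by (simp add: has_integral_0_eq)
qed

text \<open>Replacing \<open>h\<close> by its absolute value changes it only on a null set. A
  nonnegative gauge integrable function is Lebesgue integrable, so a zero integral forces it to
  vanish almost everywhere.\<close>

lemma has_integral_AE_nonneg:
  fixes h :: "real \<Rightarrow> real"
  assumes h: "(h has_integral I) S" and S: "S \<in> sets lebesgue"
    and "AE t in lebesgue_on S. 0 \<le> h t"
  shows "0 \<le> I" and "I = 0 \<Longrightarrow> AE t in lebesgue_on S. h t = 0"
proof -
  let ?N = "{t \<in> S. \<not> 0 \<le> h t}"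
  have N: "negligible ?N" using assms(3) S by (simp add: AE_lebesgue_on_iff_negligible)
  have h': "((\<lambda>t. \<bar>h t\<bar>) has_integral I) S"
    by (rule has_integral_spike[OF N _ h]) auto
  then show "0 \<le> I" by (rule has_integral_nonneg) simp
  assume "I = 0"
  have "(\<lambda>t. \<bar>h t\<bar>) absolutely_integrable_on S"
    by (rule nonnegative_absolutely_integrable_1) (use h' in auto)
  then have int: "integrable (lebesgue_on S) (\<lambda>t. \<bar>h t\<bar>)"
    using S by (simp add: integrable_restrict_space set_integrable_def)
  have "integral\<^sup>L (lebesgue_on S) (\<lambda>t. \<bar>h t\<bar>) = 0"
    using lebesgue_integral_eq_integral[OF int S] h' \<open>I = 0\<close> by (simp add: integral_unique)
  then show "AE t in lebesgue_on S. h t = 0"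
    using integral_nonneg_eq_0_iff_AE[OF int] by simp
qed

section \<open>Upper bounds for \<open>W11_norm\<close>\<close>

text \<open>For an integrable function this is monotonicity. Otherwise the Bochner integral is 0 by
  convention, and the right-hand side is nonnegative.\<close>

lemma set_lebesgue_integral_le_AE_bound:
  fixes h :: "real \<Rightarrow> real"
  assumes "AE t in lebesgue_on {a..b}. h t \<le> K" and "K \<ge> 0" and "a \<le> b"
  shows "(LINT t:{a..b}|lebesgue. h t) \<le> K * (b - a)"
proof (cases "integrable lebesgue (\<lambda>t. indicator {a..b} t *\<^sub>R h t)")
  case True
  have "(LINT t:{a..b}|lebesgue. h t) \<le> (LINT t|lebesgue. indicator {a..b} t *\<^sub>R K)"
    unfolding set_lebesgue_integral_def
  proof (rule integral_mono_AE[OF True])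
    show "integrable lebesgue (\<lambda>t. indicator {a..b} t *\<^sub>R K)"
      by (rule integrable_indicator) (auto simp: emeasure_lborel_Icc_eq)
    show "AE t in lebesgue. indicator {a..b} t *\<^sub>R h t \<le> indicator {a..b} t *\<^sub>R K"
      using assms(1) by (auto simp: AE_restrict_space_iff indicator_def)
  qed
  also have "\<dots> = K * (b - a)" using \<open>a \<le> b\<close> by simp
  finally show ?thesis .
next
  case False
  then show ?thesis
    using assms(2,3) by (simp add: set_lebesgue_integral_def not_integrable_integral_eq)
qed

lemma W11_norm_le:
  assumes "a < b" and "f a = 0" and "K \<ge> 0"
    and "AE t in lebesgue_on {a..b}.
      (f has_vector_derivative f' t) (at t within {a..b}) \<and> norm (f' t) \<le> K"
  shows "W11_norm a b f \<le> K * (b - a)"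
proof -
  have "AE t in lebesgue_on {a..b}. norm (vector_derivative f (at t within {a..b})) \<le> K"
    using AE_space assms(4)
  proof eventually_elim
    case (elim t)
    then show ?case
      using vector_derivative_within_cbox[OF \<open>a < b\<close>, of t f "f' t"] by auto
  qed
  then show ?thesis
    unfolding W11_norm_def
    using set_lebesgue_integral_le_AE_bound[where a = a and b = b and K = K] assms(1-3) by simp
qed


section \<open>The optimal control problem\<close>

locale FP1 =
  fixes a lam t0 T x0 :: real
  assumes a_gt: "lam < a" and lam_pos: "0 < lam" and t0_lt: "t0 < T" and t0_nonneg: "0 \<le> t0"
begin

text \<open>This is the integral of \<open>exp (- lam * s)\<close> over \<open>s\<close> from
  \<open>t\<close> to \<open>T\<close>: up to sign, the costate of the first state
  component.\<close>

definition E :: "real \<Rightarrow> real" where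
  "E t = (exp (- lam * t) - exp (- lam * T)) / lam"

text \<open>The switching function of the problem: its sign decides which extreme control value is
  optimal.\<close>

definition phi :: "real \<Rightarrow> real" where
  "phi t = a * E t - exp (- lam * t)"

definition tb :: real where
  "tb = T - 1 / lam * ln (a / (a - lam))"

text \<open>Clamping at \<open>t0\<close> treats both cases of the theorem at once: a short horizon
  amounts to a switch at the initial time.\<close>

definition sw :: real where "sw = max t0 tb"

definition ub :: "real \<Rightarrow> real" where
  "ub t = (if t \<le> sw then - 1 else 1)"

text \<open>The absolute value merges the two branches, of slope \<open>a\<close> before
  \<open>sw\<close> and \<open>- a\<close> after it.\<close>

definition xb :: "real \<Rightarrow> real" where
  "xb t = x0 + a * (sw - t0 - \<bar>t - sw\<bar>)"

lemma a_pos: "a > 0"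
  using a_gt lam_pos by simp

lemma rho_pos: "1 / lam * ln (a / (a - lam)) > 0"
  using a_gt lam_pos by (intro mult_pos_pos ln_gt_zero) (auto simp: field_simps)

text \<open>By the choice of \<open>tb\<close>, \<open>exp (- lam * tb)\<close> equals
  \<open>exp (- lam * T) * (a / (a - lam))\<close>. In this form the sign of \<open>phi\<close> can
  be read off.\<close>

lemma phi_eq: "phi t = (a - lam) / lam * (exp (- lam * t) - exp (- lam * tb))"
proof -
  have "exp (- lam * tb) = exp (- lam * T + ln (a / (a - lam)))"
    using lam_pos by (simp add: tb_def algebra_simps)
  also have "\<dots> = exp (- lam * T) * (a / (a - lam))"
    unfolding exp_add using a_gt a_pos by simp
  finally show ?thesis
    using a_gt lam_pos by (simp add: phi_def E_def field_simps)
qed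

lemma phi_pos: "t < tb \<Longrightarrow> phi t > 0" and phi_neg: "tb < t \<Longrightarrow> phi t < 0"
proof -
  have c: "(a - lam) / lam > 0" using a_gt lam_pos by simp
  show "phi t > 0" if "t < tb"
    unfolding phi_eq using that lam_pos by (intro mult_pos_pos[OF c]) simp
  show "phi t < 0" if "tb < t"
    unfolding phi_eq using that lam_pos by (intro mult_pos_neg[OF c]) simp
qed

lemma E_deriv: "(E has_real_derivative - exp (- lam * t)) (at t within S)"
  unfolding E_def by (rule derivative_eq_intros refl | use lam_pos in simp)+

lemma abs_cont_on_E: "abs_cont_on {t0..T} E"
  by (rule abs_cont_on_bounded_derivative[OF E_deriv, of _ _ 1])
    (use lam_pos t0_nonneg in auto)

section \<open>The cost of a feasible process and optimality\<close>

lemma feasible_abs_cont: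
  assumes "FP1a_feasible a lam t0 T x0 x u"
  shows "abs_cont_on {t0..T} x"
    "abs_cont_on {t0..T} (\<lambda>t. fst (x t))" "abs_cont_on {t0..T} (\<lambda>t. snd (x t))"
proof -
  show x: "abs_cont_on {t0..T} x" using assms by (simp add: FP1a_feasible_def W11_def)
  show "abs_cont_on {t0..T} (\<lambda>t. fst (x t))" "abs_cont_on {t0..T} (\<lambda>t. snd (x t))"
    using abs_cont_on_bounded_linear[OF x] bounded_linear_fst bounded_linear_snd by auto
qed

lemma feasibleD:
  assumes "FP1a_feasible a lam t0 T x0 x u"
  shows "x t0 = (x0, 0)"
    and "u \<in> borel_measurable (lebesgue_on {t0..T})"
    and "AE t in lebesgue_on {t0..T}. u t \<in> {-1..1}"
    and "AE t in lebesgue_on {t0..T}.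
        ((\<lambda>s. fst (x s)) has_real_derivative - a * u t) (at t within {t0..T}) \<and>
        ((\<lambda>s. snd (x s)) has_real_derivative - exp (- lam * t) * (fst (x t) + u t))
          (at t within {t0..T})"
  using assms unfolding FP1a_feasible_def admissible_control_def by blast+

lemma feasible_cost:
  assumes x: "FP1a_feasible a lam t0 T x0 x u"
  shows "((\<lambda>t. phi t * u t) has_integral (snd (x T) + E t0 * x0)) {t0..T}"
proof -
  let ?V = "\<lambda>t. snd (x t) - E t * fst (x t)"
  have "abs_cont_on {t0..T} ?V"
    by (intro abs_cont_on_diff abs_cont_on_mult abs_cont_on_E feasible_abs_cont[OF x])
  moreover have "AE t in lebesgue_on {t0..T}. (?V has_vector_derivative phi t * u t) (at t within {t0..T})"
  proof -
    show ?thesis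
      using feasibleD(4)[OF x]
    proof eventually_elim
      case (elim t)
      have "(?V has_real_derivative - exp (- lam * t) * (fst (x t) + u t)
          - (E t * (- a * u t) + - exp (- lam * t) * fst (x t))) (at t within {t0..T})"
        by (intro DERIV_diff DERIV_mult' E_deriv) (use elim in auto)
      \<comment> \<open>The terms in \<open>fst (x t)\<close> cancel because
        \<open>E' = - exp (- lam * t)\<close>; only the control remains.\<close>
      also have "- exp (- lam * t) * (fst (x t) + u t)
          - (E t * (- a * u t) + - exp (- lam * t) * fst (x t)) = phi t * u t"
        by (simp add: phi_def algebra_simps)
      finally show ?case by (simp add: has_real_derivative_iff_has_vector_derivative)
    qed
  qed
  ultimately have "((\<lambda>t. phi t * u t) has_integral (?V T - ?V t0)) {t0..T}"
    using t0_lt by (intro abs_cont_on_AE_has_integral) auto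
  \<comment> \<open>\<open>E T = 0\<close> removes the unknown terminal state, and
    \<open>snd (x t0) = 0\<close>.\<close>
  moreover have "?V T - ?V t0 = snd (x T) + E t0 * x0"
    using feasibleD(1)[OF x] by (simp add: E_def)
  ultimately show ?thesis by simp
qed

lemma AE_neq: "AE t in lebesgue_on {t0..T}. t \<noteq> c"
  by (subst AE_lebesgue_on_iff_negligible) (auto intro: negligible_subset[of "{c}"])

text \<open>Pointwise minimum principle: away from \<open>sw\<close> the value \<open>ub t\<close>
  is the unique minimizer of \<open>v \<mapsto> phi t * v\<close> on \<open>{-1..1}\<close>. A time
  \<open>t \<ge> t0\<close> with \<open>t < sw\<close> also satisfies \<open>t < tb\<close>, so the
  sign of \<open>phi t\<close> is known on both sides.\<close>

lemma phi_ub: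
  assumes "t \<in> {t0..T}" "t \<noteq> sw" "v \<in> {-1..1}"
  shows "0 \<le> phi t * (v - ub t)" "phi t * (v - ub t) = 0 \<Longrightarrow> v = ub t"
proof -
  consider "t < tb" "t < sw" | "tb < t" "sw < t"
    using assms by (fastforce simp: sw_def max_def split: if_splits)
  then show "0 \<le> phi t * (v - ub t)" "phi t * (v - ub t) = 0 \<Longrightarrow> v = ub t"
    using phi_pos[of t] phi_neg[of t] assms(3)
    by (cases; auto simp: ub_def intro: mult_nonneg_nonneg mult_nonpos_nonpos)+
qed

text \<open>The cost difference is the integral of \<open>phi t * (u t - ub t)\<close>, which is
  nonnegative almost everywhere. Equal costs make it vanish almost everywhere, and strictness in
  \<open>phi_ub\<close> identifies the controls.\<close>

lemma optimal:
  assumes x: "FP1a_feasible a lam t0 T x0 x u" and z: "FP1a_feasible a lam t0 T x0 z ub"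
  shows "snd (z T) \<le> snd (x T)"
    and "snd (x T) = snd (z T) \<Longrightarrow> AE t in lebesgue_on {t0..T}. u t = ub t"
proof -
  have "((\<lambda>t. phi t * u t - phi t * ub t) has_integral
      (snd (x T) + E t0 * x0 - (snd (z T) + E t0 * x0))) {t0..T}"
    by (intro has_integral_diff feasible_cost x z)
  then have int: "((\<lambda>t. phi t * (u t - ub t)) has_integral (snd (x T) - snd (z T))) {t0..T}"
    by (simp add: right_diff_distrib)
  from AE_space AE_neq[of sw] feasibleD(3)[OF x]
  have sgn: "AE t in lebesgue_on {t0..T}. 0 \<le> phi t * (u t - ub t) \<and>
      (phi t * (u t - ub t) = 0 \<longrightarrow> u t = ub t)"
  proof eventually_elim
    case (elim t)
    then show ?case using phi_ub[of t "u t"] by simp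
  qed
  then have nonneg: "AE t in lebesgue_on {t0..T}. 0 \<le> phi t * (u t - ub t)" by auto
  show "snd (z T) \<le> snd (x T)"
    using has_integral_AE_nonneg(1)[OF int _ nonneg] by simp
  assume "snd (x T) = snd (z T)"
  then have "AE t in lebesgue_on {t0..T}. phi t * (u t - ub t) = 0"
    using has_integral_AE_nonneg(2)[OF int _ nonneg] by simp
  with sgn show "AE t in lebesgue_on {t0..T}. u t = ub t" by auto
qed

section \<open>Feasibility of the bang-bang candidate\<close>

lemma sw_bounds: "t0 \<le> sw" "sw < T"
  using t0_lt rho_pos by (auto simp: sw_def tb_def)

lemma ub_bounds: "ub t \<in> {-1..1}"
  by (simp add: ub_def)

lemma ub_measurable: "ub \<in> borel_measurable borel"
  unfolding ub_def by measurable

lemma admissible_ub: "admissible_control t0 T ub"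
  using ub_bounds ub_measurable
  by (auto simp: admissible_control_def intro!: measurable_restrict_space1 measurable_completion)

lemma xb_t0: "xb t0 = x0"
  using sw_bounds by (simp add: xb_def)

lemma xb_continuous: "continuous_on S xb"
  unfolding xb_def by (intro continuous_intros)

lemma abs_cont_on_xb: "abs_cont_on S xb"
proof (rule abs_cont_on_Lipschitz[of a])
  fix r s :: real assume "r \<le> s"
  have "norm (xb s - xb r) = a * \<bar>\<bar>r - sw\<bar> - \<bar>s - sw\<bar>\<bar>"
    using a_pos by (simp add: xb_def abs_mult flip: right_diff_distrib)
  also have "\<dots> \<le> a * (s - r)"
    using a_pos \<open>r \<le> s\<close> by (intro mult_left_mono) auto
  finally show "norm (xb s - xb r) \<le> a * (s - r)" .
qed (use a_pos in simp)

text \<open>On each open half-line bounded by \<open>sw\<close> the function \<open>xb\<close> is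
  affine.\<close>

lemma xb_deriv:
  assumes "t \<noteq> sw"
  shows "(xb has_real_derivative - a * ub t) (at t within S)"
proof (cases "t < sw")
  case True
  have "((\<lambda>t. x0 + a * (t - t0)) has_real_derivative - a * ub t) (at t)"
    using True by (auto intro!: derivative_eq_intros simp: ub_def)
  then have "(xb has_real_derivative - a * ub t) (at t)"
    by (rule has_field_derivative_transform_within_open[of _ _ _ "{..<sw}"])
      (use True in \<open>auto simp: xb_def algebra_simps\<close>)
  then show ?thesis by (rule has_field_derivative_at_within)
next
  case False
  have "((\<lambda>t. x0 + a * (2 * sw - t0 - t)) has_real_derivative - a * ub t) (at t)"
    using False assms by (auto intro!: derivative_eq_intros simp: ub_def)
  then have "(xb has_real_derivative - a * ub t) (at t)"
    by (rule has_field_derivative_transform_within_open[of _ _ _ "{sw<..}"])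
      (use False assms in \<open>auto simp: xb_def algebra_simps\<close>)
  then show ?thesis by (rule has_field_derivative_at_within)
qed

lemma FP1_feasible_xb: "FP1_feasible a t0 T x0 xb ub"
  unfolding FP1_feasible_def W11_def
  using eventually_mono[OF AE_neq xb_deriv] by (simp add: abs_cont_on_xb admissible_ub xb_t0)

text \<open>Away from \<open>sw\<close> the control is locally constant. This continuity is what
  allows \<open>J\<close> to be differentiated in its upper limit.\<close>

lemma running_cost_continuous:
  assumes "t \<noteq> sw"
  shows "isCont (\<lambda>t. - exp (- lam * t) * (xb t + ub t)) t"
proof -
  have "\<forall>\<^sub>F s in nhds t. ub s = ub t"
  proof (cases "t < sw")
    case True
    then show ?thesis
      using eventually_nhds_in_open[of "{..<sw}" t] by (auto simp: ub_def elim!: eventually_mono)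
  next
    case False
    then show ?thesis
      using assms eventually_nhds_in_open[of "{sw<..}" t]
      by (auto simp: ub_def elim!: eventually_mono)
  qed
  then have "isCont ub t"
    using isCont_cong[of ub "\<lambda>_. ub t" t] by simp
  moreover have "isCont xb t"
    using xb_continuous[of UNIV] by (simp add: continuous_on_eq_continuous_at)
  ultimately show ?thesis by (intro continuous_intros)
qed

text \<open>Allows the Lebesgue integral in \<open>J\<close> to be treated as a gauge integral. The
  integrand is dominated by a continuous function because \<open>ub\<close> is bounded by 1.\<close>

lemma running_cost_absolutely_integrable:
  "(\<lambda>t. - exp (- lam * t) * (xb t + ub t)) absolutely_integrable_on {r..s}"
proof (rule measurable_bounded_by_integrable_imp_absolutely_integrable)
  have "xb \<in> borel_measurable borel"
    using xb_continuous by (rule borel_measurable_continuous_onI)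
  then have "(\<lambda>t. - exp (- lam * t) * (xb t + ub t)) \<in> borel_measurable borel"
    using ub_measurable by measurable
  then show "(\<lambda>t. - exp (- lam * t) * (xb t + ub t)) \<in> borel_measurable (lebesgue_on {r..s})"
    by (auto intro!: measurable_restrict_space1 measurable_completion)
  show "(\<lambda>t. exp (- lam * t) * (\<bar>xb t\<bar> + 1)) integrable_on {r..s}"
    by (intro integrable_continuous_real continuous_intros xb_continuous)
  fix t
  have "\<bar>xb t + ub t\<bar> \<le> \<bar>xb t\<bar> + 1"
    using ub_bounds[of t] by auto
  then show "norm (- exp (- lam * t) * (xb t + ub t)) \<le> exp (- lam * t) * (\<bar>xb t\<bar> + 1)"
    by (simp add: abs_mult)
qed simp

lemma J_eq_integral:
  "J lam t0 t xb ub = integral {t0..t} (\<lambda>t. - exp (- lam * t) * (xb t + ub t))"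
  unfolding J_def
  by (rule set_lebesgue_integral_eq_integral(2)[OF running_cost_absolutely_integrable])

lemma J_deriv:
  assumes "t \<in> {t0..T}" "t \<noteq> sw"
  shows "((\<lambda>s. J lam t0 s xb ub) has_real_derivative - exp (- lam * t) * (xb t + ub t))
    (at t within {t0..T})"
proof -
  have "((\<lambda>s. J lam t0 s xb ub) has_vector_derivative - exp (- lam * t) * (xb t + ub t))
      (at t within ({t0..T} - {sw}))"
    unfolding J_eq_integral
    using assms
    by (intro integral_has_vector_derivative_continuous_at[
          OF set_lebesgue_integral_eq_integral(1)[OF running_cost_absolutely_integrable] _ _
            continuous_at_imp_continuous_at_within[OF running_cost_continuous]]) simp_all
  \<comment> \<open>Deleting \<open>sw\<close> does not change the filter, since
    \<open>- {sw}\<close> is an open neighbourhood of \<open>t\<close>.\<close>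
  moreover have "at t within ({t0..T} - {sw}) = at t within {t0..T}"
    by (rule at_within_nhd[of t "- {sw}"]) (use assms in auto)
  ultimately show ?thesis
    by (simp add: has_real_derivative_iff_has_vector_derivative)
qed

text \<open>The running cost is bounded by \<open>M + 1\<close>, with \<open>M\<close> a bound for
  \<open>xb\<close>, as the exponential is at most 1 at nonnegative times. Hence \<open>J\<close> is
  Lipschitz in its upper limit.\<close>

lemma abs_cont_on_J: "abs_cont_on {t0..T} (\<lambda>t. J lam t0 t xb ub)"
proof -
  let ?g = "\<lambda>t. - exp (- lam * t) * (xb t + ub t)"
  have int: "?g integrable_on {r..s}" for r s
    by (rule set_lebesgue_integral_eq_integral(1)[OF running_cost_absolutely_integrable])
  have "bounded (xb ` {t0..T})"
    by (intro compact_imp_bounded compact_continuous_image xb_continuous) simp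
  then obtain M where M: "M > 0" "\<And>t. t \<in> {t0..T} \<Longrightarrow> \<bar>xb t\<bar> \<le> M"
    unfolding bounded_pos by auto
  have bound: "norm (?g t) \<le> M + 1" if "t \<in> {t0..T}" for t
  proof -
    have "\<bar>xb t + ub t\<bar> \<le> M + 1"
      using M(2)[OF that] ub_bounds[of t] by auto
    moreover have "exp (- lam * t) \<le> 1"
      using that t0_nonneg lam_pos by simp
    ultimately have "exp (- lam * t) * \<bar>xb t + ub t\<bar> \<le> 1 * (M + 1)"
      by (intro mult_mono) auto
    then show ?thesis by (simp add: abs_mult)
  qed
  show ?thesis
  proof (rule abs_cont_on_Lipschitz)
    fix r s :: real assume rs: "r \<le> s" "{r..s} \<subseteq> {t0..T}"
    then have "t0 \<le> r" by simp
    have "norm (integral {r..s} ?g) \<le> (M + 1) * measure lborel {r..s}"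
      by (rule has_integral_bound_real[OF _ _ integrable_integral[OF int], of _ "{}"])
        (use M(1) bound rs in auto)
    moreover have "integral {t0..r} ?g + integral {r..s} ?g = integral {t0..s} ?g"
      using \<open>t0 \<le> r\<close> rs(1) by (intro Henstock_Kurzweil_Integration.integral_combine int)
    ultimately show "norm (J lam t0 s xb ub - J lam t0 r xb ub) \<le> (M + 1) * (s - r)"
      using rs(1) by (simp add: J_eq_integral)
  qed (use M(1) in simp)
qed

lemma FP1a_feasible_mayer_xb: "FP1a_feasible a lam t0 T x0 (mayer_state lam t0 xb ub) ub"
proof -
  have "AE t in lebesgue_on {t0..T}.
      (xb has_real_derivative - a * ub t) (at t within {t0..T}) \<and>
      ((\<lambda>s. J lam t0 s xb ub) has_real_derivative - exp (- lam * t) * (xb t + ub t))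
        (at t within {t0..T})"
    using AE_space AE_neq[of sw]
  proof eventually_elim
    case (elim t)
    then show ?case using xb_deriv J_deriv by simp
  qed
  moreover have "mayer_state lam t0 xb ub \<in> W11 t0 T"
    using abs_cont_on_Pair[OF abs_cont_on_xb abs_cont_on_J]
    by (simp add: W11_def mayer_state_def[abs_def])
  moreover have "J lam t0 t0 xb ub = 0"
    by (simp add: J_eq_integral)
  ultimately show ?thesis
    by (simp add: FP1a_feasible_def admissible_ub mayer_state_def xb_t0)
qed

lemma global_minimizer: "FP1a_global_minimizer a lam t0 T x0 (mayer_state lam t0 xb ub) ub"
  unfolding FP1a_global_minimizer_def
  using FP1a_feasible_mayer_xb optimal(1) by blast

section \<open>Convexity and local minimizers\<close>

text \<open>The dynamics are linear in state and control jointly, the initial value is shared, and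
  the control set is an interval. Writing the combination as a step from \<open>x\<close> exposes
  the perturbation \<open>\<theta> *\<^sub>R (z t - x t)\<close>.\<close>

lemma feasible_convex:
  assumes x: "FP1a_feasible a lam t0 T x0 x u" and z: "FP1a_feasible a lam t0 T x0 z v"
    and \<theta>: "0 \<le> \<theta>" "\<theta> \<le> 1"
  shows "FP1a_feasible a lam t0 T x0 (\<lambda>t. x t + \<theta> *\<^sub>R (z t - x t)) (\<lambda>t. u t + \<theta> * (v t - u t))"
proof -
  have "abs_cont_on {t0..T} (\<lambda>t. x t + \<theta> *\<^sub>R (z t - x t))"
    using feasible_abs_cont(1)[OF x] feasible_abs_cont(1)[OF z]
    by (intro abs_cont_on_add abs_cont_on_bounded_linear[OF _ bounded_linear_scaleR_right] abs_cont_on_diff)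
  moreover have "(\<lambda>t. u t + \<theta> * (v t - u t)) \<in> borel_measurable (lebesgue_on {t0..T})"
    by (intro borel_measurable_add borel_measurable_times borel_measurable_diff
        borel_measurable_const feasibleD(2)[OF x] feasibleD(2)[OF z])
  moreover have "AE t in lebesgue_on {t0..T}. u t + \<theta> * (v t - u t) \<in> {-1..1}"
    using feasibleD(3)[OF x] feasibleD(3)[OF z]
  proof eventually_elim
    case (elim t)
    have "(1 - \<theta>) *\<^sub>R u t + \<theta> *\<^sub>R v t \<in> {-1..1}"
      by (rule convexD[OF convex_real_interval(5)]) (use elim \<theta> in auto)
    moreover have "(1 - \<theta>) *\<^sub>R u t + \<theta> *\<^sub>R v t = u t + \<theta> * (v t - u t)"
      by (simp add: algebra_simps)
    ultimately show ?case by simp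
  qed
  moreover have "AE t in lebesgue_on {t0..T}.
      ((\<lambda>s. fst (x s + \<theta> *\<^sub>R (z s - x s))) has_real_derivative - a * (u t + \<theta> * (v t - u t)))
        (at t within {t0..T}) \<and>
      ((\<lambda>s. snd (x s + \<theta> *\<^sub>R (z s - x s))) has_real_derivative
        - exp (- lam * t) * (fst (x t + \<theta> *\<^sub>R (z t - x t)) + (u t + \<theta> * (v t - u t))))
        (at t within {t0..T})"
    using feasibleD(4)[OF x] feasibleD(4)[OF z]
  proof eventually_elim
    case (elim t)
    have "((\<lambda>s. fst (x s) + \<theta> * (fst (z s) - fst (x s))) has_real_derivative
        - a * u t + \<theta> * (- a * v t - - a * u t)) (at t within {t0..T})"
      by (intro DERIV_add DERIV_cmult DERIV_diff; use elim in blast)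
    moreover have "((\<lambda>s. snd (x s) + \<theta> * (snd (z s) - snd (x s))) has_real_derivative
        - exp (- lam * t) * (fst (x t) + u t) +
        \<theta> * (- exp (- lam * t) * (fst (z t) + v t) - - exp (- lam * t) * (fst (x t) + u t)))
        (at t within {t0..T})"
      by (intro DERIV_add DERIV_cmult DERIV_diff; use elim in blast)
    moreover have "- a * u t + \<theta> * (- a * v t - - a * u t) = - a * (u t + \<theta> * (v t - u t))"
      by (simp add: algebra_simps)
    moreover have "- exp (- lam * t) * (fst (x t) + u t) +
        \<theta> * (- exp (- lam * t) * (fst (z t) + v t) - - exp (- lam * t) * (fst (x t) + u t))
      = - exp (- lam * t) * (fst (x t) + \<theta> * (fst (z t) - fst (x t)) + (u t + \<theta> * (v t - u t)))"
      by (simp add: algebra_simps)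
    ultimately show ?case by simp
  qed
  ultimately show ?thesis
    using feasibleD(1)[OF x] feasibleD(1)[OF z]
    by (simp add: FP1a_feasible_def admissible_control_def W11_def)
qed

text \<open>Provides a uniform bound on the speed of \<open>z - x\<close>, so that small multiples
  of it are small in \<open>W11_norm\<close>. The bound \<open>a * 2 + (M + 2)\<close> adds the
  bounds of the two components, using \<open>\<bar>v t - u t\<bar> \<le> 2\<close>.\<close>

lemma feasible_diff_derivative:
  assumes x: "FP1a_feasible a lam t0 T x0 x u" and z: "FP1a_feasible a lam t0 T x0 z v"
  obtains K where "K \<ge> 0"
    "AE t in lebesgue_on {t0..T}. ((\<lambda>s. z s - x s) has_vector_derivative
        (- a * (v t - u t), - exp (- lam * t) * (fst (z t - x t) + (v t - u t))))
        (at t within {t0..T}) \<and>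
      norm (- a * (v t - u t), - exp (- lam * t) * (fst (z t - x t) + (v t - u t))) \<le> K"
proof -
  have "continuous_on {t0..T} (\<lambda>t. fst (z t - x t))"
    using feasible_abs_cont(1)[OF x] feasible_abs_cont(1)[OF z]
    by (intro continuous_intros abs_cont_on_imp_continuous_on)
  then have "bounded ((\<lambda>t. fst (z t - x t)) ` {t0..T})"
    by (intro compact_imp_bounded compact_continuous_image) auto
  then obtain M where M: "M > 0" "\<And>t. t \<in> {t0..T} \<Longrightarrow> \<bar>fst (z t - x t)\<bar> \<le> M"
    unfolding bounded_pos by auto
  from AE_space feasibleD(3,4)[OF x] feasibleD(3,4)[OF z]
  have "AE t in lebesgue_on {t0..T}. ((\<lambda>s. z s - x s) has_vector_derivative
        (- a * (v t - u t), - exp (- lam * t) * (fst (z t - x t) + (v t - u t))))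
        (at t within {t0..T}) \<and>
      norm (- a * (v t - u t), - exp (- lam * t) * (fst (z t - x t) + (v t - u t)))
        \<le> a * 2 + (M + 2)"
  proof eventually_elim
    case (elim t)
    have "((\<lambda>s. fst (z s) - fst (x s)) has_real_derivative - a * v t - - a * u t) (at t within {t0..T})"
      by (intro DERIV_diff; use elim in blast)
    moreover have "((\<lambda>s. snd (z s) - snd (x s)) has_real_derivative
        - exp (- lam * t) * (fst (z t) + v t) - - exp (- lam * t) * (fst (x t) + u t))
        (at t within {t0..T})"
      by (intro DERIV_diff; use elim in blast)
    ultimately have "((\<lambda>s. (fst (z s) - fst (x s), snd (z s) - snd (x s))) has_vector_derivative
        (- a * v t - - a * u t,
         - exp (- lam * t) * (fst (z t) + v t) - - exp (- lam * t) * (fst (x t) + u t)))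
        (at t within {t0..T})"
      unfolding has_real_derivative_iff_has_vector_derivative by (rule has_vector_derivative_Pair)
    moreover have "(\<lambda>s. (fst (z s) - fst (x s), snd (z s) - snd (x s))) = (\<lambda>s. z s - x s)"
      by (simp add: minus_prod_def)
    moreover have "- a * v t - - a * u t = - a * (v t - u t)"
      "- exp (- lam * t) * (fst (z t) + v t) - - exp (- lam * t) * (fst (x t) + u t)
        = - exp (- lam * t) * (fst (z t - x t) + (v t - u t))"
      by (simp_all add: algebra_simps)
    ultimately have "((\<lambda>s. z s - x s) has_vector_derivative
        (- a * (v t - u t), - exp (- lam * t) * (fst (z t - x t) + (v t - u t)))) (at t within {t0..T})"
      by (simp only:)
    moreover have "norm (- a * (v t - u t), - exp (- lam * t) * (fst (z t - x t) + (v t - u t)))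
        \<le> a * 2 + (M + 2)"
    proof (rule norm_Pair_le[THEN order_trans], rule add_mono)
      have vu: "\<bar>v t - u t\<bar> \<le> 2" using elim by auto
      then show "norm (- a * (v t - u t)) \<le> a * 2"
        using a_pos by (simp add: abs_mult)
      have t: "t \<in> {t0..T}" using elim by simp
      have "exp (- lam * t) * \<bar>fst (z t - x t) + (v t - u t)\<bar> \<le> 1 * (M + 2)"
      proof (rule mult_mono)
        show "exp (- lam * t) \<le> 1" using t t0_nonneg lam_pos by simp
        show "\<bar>fst (z t - x t) + (v t - u t)\<bar> \<le> M + 2"
          using M(2)[OF t] vu by linarith
      qed auto
      then show "norm (- exp (- lam * t) * (fst (z t - x t) + (v t - u t))) \<le> M + 2"
        by (simp add: abs_mult)
    qed
    ultimately show ?case by blast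
  qed
  then show thesis
    using that[of "a * 2 + (M + 2)"] a_pos M(1) by simp
qed

text \<open>
  The feasible set is convex and the cost is affine on it, so moving from a local minimizer
  slightly towards the global one cannot decrease the cost.
\<close>

lemma local_minimizer_cost:
  assumes loc: "FP1a_local_minimizer a lam t0 T x0 x u" and z: "FP1a_feasible a lam t0 T x0 z v"
  shows "snd (x T) \<le> snd (z T)"
proof -
  have x: "FP1a_feasible a lam t0 T x0 x u"
    using loc by (simp add: FP1a_local_minimizer_def)
  obtain \<delta> where \<delta>: "\<delta> > 0" and min: "\<And>y w. FP1a_feasible a lam t0 T x0 y w \<Longrightarrow>
      W11_norm t0 T (\<lambda>t. x t - y t) \<le> \<delta> \<Longrightarrow> snd (x T) \<le> snd (y T)"
    using loc unfolding FP1a_local_minimizer_def by blast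
  obtain K where K: "K \<ge> 0" and d: "AE t in lebesgue_on {t0..T}. ((\<lambda>s. z s - x s) has_vector_derivative
        (- a * (v t - u t), - exp (- lam * t) * (fst (z t - x t) + (v t - u t))))
        (at t within {t0..T}) \<and>
      norm (- a * (v t - u t), - exp (- lam * t) * (fst (z t - x t) + (v t - u t))) \<le> K"
    by (rule feasible_diff_derivative[OF x z])
  \<comment> \<open>Small enough for the perturbed process to stay within \<open>\<delta>\<close> of
    \<open>x\<close>, and at most 1 for convexity; the added 1 avoids a zero denominator when
    \<open>K = 0\<close>.\<close>
  define \<theta> where "\<theta> = min 1 (\<delta> / (K * (T - t0) + 1))"
  have KT: "K * (T - t0) \<ge> 0" using K t0_lt by simp
  then have \<theta>: "0 < \<theta>" "\<theta> \<le> 1" using \<delta> by (auto simp: \<theta>_def)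
  have "\<theta> * (K * (T - t0)) \<le> \<delta> / (K * (T - t0) + 1) * (K * (T - t0) + 1)"
    using KT \<delta> by (intro mult_mono) (auto simp: \<theta>_def)
  then have small: "\<theta> * K * (T - t0) \<le> \<delta>" using KT by simp
  \<comment> \<open>The sign is negative because the definition of a local minimizer measures the
    candidate minus the competitor.\<close>
  let ?f' = "\<lambda>t. (- \<theta>) *\<^sub>R (- a * (v t - u t), - exp (- lam * t) * (fst (z t - x t) + (v t - u t)))"
  have "W11_norm t0 T (\<lambda>t. (- \<theta>) *\<^sub>R (z t - x t)) \<le> \<theta> * K * (T - t0)"
  proof (rule W11_norm_le[OF t0_lt, where f' = ?f'])
    show "(- \<theta>) *\<^sub>R (z t0 - x t0) = 0"
      using feasibleD(1)[OF x] feasibleD(1)[OF z] by simp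
    show "AE t in lebesgue_on {t0..T}.
        ((\<lambda>t. (- \<theta>) *\<^sub>R (z t - x t)) has_vector_derivative ?f' t) (at t within {t0..T}) \<and>
        norm (?f' t) \<le> \<theta> * K"
      using d
    proof eventually_elim
      case (elim t)
      then show ?case
        using \<theta>(1) bounded_linear.has_vector_derivative[OF bounded_linear_scaleR_right]
        by (auto simp only: norm_scaleR intro!: mult_mono norm_ge_zero)
    qed
  qed (use \<theta> K in auto)
  also have "(\<lambda>t. (- \<theta>) *\<^sub>R (z t - x t)) = (\<lambda>t. x t - (x t + \<theta> *\<^sub>R (z t - x t)))"
    by auto
  finally have "snd (x T) \<le> snd (x T + \<theta> *\<^sub>R (z T - x T))"
    using small \<theta> by (intro min[OF feasible_convex[OF x z]]) auto
  \<comment> \<open>The terminal cost is affine in \<open>\<theta>\<close>, so cancelling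
    \<open>snd (x T)\<close> and dividing by \<open>\<theta> > 0\<close> leaves the claim.\<close>
  then show ?thesis using \<theta>(1) by (simp add: zero_le_mult_iff)
qed

section \<open>Uniqueness of the local solution\<close>

text \<open>A local solution costs no more than the candidate, which is globally optimal, so the
  costs agree and the controls coincide almost everywhere. The states then share derivatives almost
  everywhere and the initial value.\<close>

lemma local_solution_unique:
  assumes loc: "FP1_local_solution a lam t0 T x0 x u"
  shows "AE t in lebesgue_on {t0..T}. u t = ub t" and "t \<in> {t0..T} \<Longrightarrow> x t = xb t"
proof -
  let ?x = "mayer_state lam t0 x u" and ?z = "mayer_state lam t0 xb ub"
  have x: "FP1_feasible a t0 T x0 x u" and min: "FP1a_local_minimizer a lam t0 T x0 ?x u"
    using loc by (auto simp: FP1_local_solution_def)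
  then have feas: "FP1a_feasible a lam t0 T x0 ?x u"
    by (simp add: FP1a_local_minimizer_def)
  have "snd (?x T) = snd (?z T)"
    using local_minimizer_cost[OF min FP1a_feasible_mayer_xb] optimal(1)[OF feas FP1a_feasible_mayer_xb]
    by simp
  then show u: "AE t in lebesgue_on {t0..T}. u t = ub t"
    by (rule optimal(2)[OF feas FP1a_feasible_mayer_xb])
  assume t: "t \<in> {t0..T}"
  have "AE t in lebesgue_on {t0..T}. (x has_real_derivative - a * u t) (at t within {t0..T})"
    using x by (simp add: FP1_feasible_def)
  with u AE_neq[of sw]
  have "AE t in lebesgue_on {t0..T}. ((\<lambda>s. x s - xb s) has_vector_derivative 0) (at t within {t0..T})"
  proof eventually_elim
    case (elim t)
    then show ?case
      using DERIV_diff[OF elim(3) xb_deriv[OF elim(2)]]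
      by (simp add: has_real_derivative_iff_has_vector_derivative)
  qed
  moreover have "abs_cont_on {t0..T} (\<lambda>s. x s - xb s)"
    using x by (intro abs_cont_on_diff abs_cont_on_xb) (simp add: FP1_feasible_def W11_def)
  ultimately have "x t - xb t = x t0 - xb t0"
    using abs_cont_on_AE_zero_derivative t by blast
  then show "x t = xb t" using x by (simp add: FP1_feasible_def xb_t0)
qed

text \<open>Differentiability is part of the claim because \<open>vector_derivative\<close> is
  unspecified where no derivative exists. The derivative within \<open>{t0..T}\<close> is unique as
  the interval is nondegenerate.\<close>

lemma ub_eq_vector_derivative:
  "AE t in lebesgue_on {t0..T}. xb differentiable (at t within {t0..T}) \<and>
    ub t = - inverse a * vector_derivative xb (at t within {t0..T})"
  using AE_space AE_neq[of sw]
proof eventually_elim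
  case (elim t)
  have d: "(xb has_vector_derivative - a * ub t) (at t within {t0..T})"
    using xb_deriv[OF elim(2)] by (simp add: has_real_derivative_iff_has_vector_derivative)
  then have "vector_derivative xb (at t within {t0..T}) = - a * ub t"
    using vector_derivative_within_cbox[OF t0_lt, of t xb] elim(1) by simp
  then show ?case
    using a_pos d by (auto intro: differentiableI_vector)
qed

end

theorem theorem3p1:
  fixes a lam t0 T x0 rho tb :: real
  assumes "a > lam" and "lam > 0" and "T > t0" and "t0 \<ge> 0"
    and "rho = 1 / lam * ln (a / (a - lam))"
    and "tb = T - rho"
  shows "rho > 0 \<and>
    (\<exists>xb ub.
       FP1_local_solution a lam t0 T x0 xb ub \<and>
       FP1_global_solution a lam t0 T x0 xb ub \<and>
       (\<forall>x u. FP1_local_solution a lam t0 T x0 x u \<longrightarrow>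
          (\<forall>t\<in>{t0..T}. x t = xb t) \<and> (AE t in lebesgue_on {t0..T}. u t = ub t)) \<and>
       (AE t in lebesgue_on {t0..T}.
          xb differentiable (at t within {t0..T}) \<and>
          ub t = - inverse a * vector_derivative xb (at t within {t0..T})) \<and>
       (t0 \<ge> tb \<longrightarrow> (\<forall>t\<in>{t0..T}. xb t = x0 - a * (t - t0))) \<and>
       (t0 < tb \<longrightarrow>
          (\<forall>t\<in>{t0..tb}. xb t = x0 + a * (t - t0)) \<and>
          (\<forall>t\<in>{tb<..T}. xb t = x0 - a * (t + t0 - 2 * tb))))"
proof -
  interpret P: FP1 a lam t0 T x0 by unfold_locales (use assms(1-4) in simp_all)
  have tb: "P.tb = tb" using assms(5,6) by (simp add: P.tb_def)
  have global: "FP1_global_solution a lam t0 T x0 P.xb P.ub"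
    using P.FP1_feasible_xb P.global_minimizer by (simp add: FP1_global_solution_def)
  \<comment> \<open>Any radius works for a global minimizer; 1 is taken.\<close>
  then have loc: "FP1_local_solution a lam t0 T x0 P.xb P.ub"
    unfolding FP1_global_solution_def FP1_local_solution_def
      FP1a_global_minimizer_def FP1a_local_minimizer_def
    using zero_less_one by blast
  have "rho > 0" using P.rho_pos assms(5) by simp
  \<comment> \<open>Here \<open>P.sw\<close> is \<open>t0\<close>, so only the descending branch of
    \<open>P.xb\<close> is present; in the other case \<open>P.sw\<close> is
    \<open>tb\<close>.\<close>
  moreover have "\<forall>t\<in>{t0..T}. P.xb t = x0 - a * (t - t0)" if "t0 \<ge> tb"
    using that by (auto simp: P.xb_def P.sw_def tb algebra_simps)
  moreover have "(\<forall>t\<in>{t0..tb}. P.xb t = x0 + a * (t - t0)) \<and>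
      (\<forall>t\<in>{tb<..T}. P.xb t = x0 - a * (t + t0 - 2 * tb))" if "t0 < tb"
    using that by (auto simp: P.xb_def P.sw_def tb algebra_simps)
  ultimately show ?thesis
    using loc global P.local_solution_unique P.ub_eq_vector_derivative by blast
qed

end
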